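(* For all but at most $O(X/\log\log X)$ values of the integer $n$ with $3\le n\le X$, we have $$\kappa(n)>\frac{\log n}{\log\log n}.$$
   Context: For a positive integer $n$, $\kappa(n)$ denotes the smallest positive integer such that $\kappa(n)n+1$ is prime. The estimate is as $X\to+\infty$. *)

theory Defs
  imports
    Complex_Main
    "HOL-Computational_Algebra.Primes"
    "HOL-Library.Landau_Symbols"
begin

(* For n > 0 such a k exists by Dirichlet's theorem for the residue class 1 mod n,
   so the LEAST is a genuine minimum; for n = 0 the value is unspecified. *)
definition kappa :: "nat \<Rightarrow> nat" where
  "kappa n = (LEAST k. k > 0 \<and> prime (k * n + 1))"

end

theory Submission
  imports
    Defs
    "HOL-Number_Theory.Pocklington"
    "HOL-Computational_Algebra.Squarefree"
    "HOL-Analysis.Harmonic_Numbers"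
    "HOL-Real_Asymp.Real_Asymp"
begin

text \<open>
  If \<open>kappa n\<close> is at most \<open>ln n / ln (ln n)\<close>, then \<open>k * n + 1\<close> is prime for some positive
  \<open>k \<le> K = ln X / ln (ln X)\<close>, so a union bound over \<open>k\<close> reduces the claim to counting, for each
  \<open>k\<close>, the \<open>n \<le> X\<close> with \<open>k * n + 1\<close> prime.  This count should be about
  \<open>X / ln X\<close> times \<open>k / totient k\<close>, a factor that is bounded on average over \<open>k\<close>; the sum over
  \<open>k \<le> K\<close> is then \<open>O(K * X / ln X) = O(X / ln (ln X))\<close>.  Losing even a factor \<open>ln k\<close> in the
  individual bounds, as Chebyshev's method for progressions does, would make the result trivial.
  An upper bound sieve is precise enough.

  The sieve is Selberg's (\<open>selberg_sieve\<close>), with squarefree moduli encoded as finite sets of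
  primes: divisors become subsets, least common multiples become unions, and the Moebius function
  becomes \<open>(-1) ^ card A\<close>.  It bounds the number of \<open>n \<le> N\<close> with \<open>k * n + 1\<close> prime by \<open>N / G\<close> plus
  a small error, where \<open>G\<close> is the sum of \<open>1 / d\<close> over the squarefree \<open>d \<le> z\<close> coprime to \<open>k\<close>.
  Writing every \<open>n \<le> z\<close> as such a \<open>d\<close> times a divisor of \<open>k\<close> times a square shows that \<open>ln z\<close> is
  at most \<open>2 * G\<close> times the sum of \<open>1 / a\<close> over the divisors \<open>a\<close> of \<open>k\<close>
  (\<open>harm_le_sieve_sum\<close>).  That divisor sum plays the part of \<open>k / totient k\<close>, and its average over
  \<open>k\<close> is at most \<open>2\<close> (\<open>sum_divisor_recip_sum_le\<close>).  The level \<open>z = X powr (1/8)\<close> keeps the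
  error at \<open>O(X powr (1/2))\<close> for each \<open>k\<close>.

  The reduction to primes \<open>k * n + 1\<close> presupposes that the minimum defining \<open>kappa n\<close> is attained,
  that is, Dirichlet's theorem for the residue class \<open>1\<close> (\<open>exists_prime_cong_1\<close>).  It follows by
  evaluating the \<open>n\<close>-th cyclotomic polynomial at \<open>n\<close>: a prime dividing that value has \<open>n\<close> of exact
  order \<open>n\<close> modulo it, and the value is not a unit.
\<close>

section \<open>Sets of primes and their products\<close>

lemma prod_dvd_iff_primes:
  fixes A :: "nat set" and n :: nat
  assumes "finite A" "\<And>p. p \<in> A \<Longrightarrow> prime p"
  shows "\<Prod>A dvd n \<longleftrightarrow> (\<forall>p\<in>A. p dvd n)"
  using assms
proof (induction A)
  case (insert q A)
  have "coprime q (\<Prod>A)"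
    using insert by (intro prod_coprime_right) (auto intro: primes_coprime)
  then show ?case using insert by (auto intro: divides_mult dest: dvd_mult_left dvd_mult_right)
qed auto

text \<open>
  A set of primes can be recovered from its product, so sums over sets of primes are sums over
  squarefree numbers.
\<close>
lemma prime_divisors_prod_primes:
  fixes A :: "nat set"
  assumes "finite A" "\<And>p. p \<in> A \<Longrightarrow> prime p"
  shows "{p. prime p \<and> p dvd \<Prod>A} = A"
proof (intro equalityI subsetI)
  fix q assume "q \<in> {p. prime p \<and> p dvd \<Prod>A}"
  then obtain p where "p \<in> A" "prime q" "q dvd p" using assms(1) by (auto simp: prime_dvd_prod_iff)
  then show "q \<in> A" using assms(2) primes_dvd_imp_eq by blast
qed (use assms in \<open>auto intro: dvd_prodI\<close>)

section \<open>Primes congruent to 1\<close>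

text \<open>
  The quotient \<open>(a ^ m - 1) / (a ^ d - 1)\<close> is a geometric sum of \<open>m / d\<close> terms, each congruent
  to \<open>1\<close> modulo \<open>p\<close>; it is therefore congruent to \<open>m / d\<close> and prime to \<open>p\<close>.
\<close>
lemma multiplicity_power_minus_1:
  fixes a m d p :: nat
  assumes p: "prime p" and a: "a \<ge> 2" and d: "d dvd m" "m > 0"
    and pd: "p dvd a ^ d - 1" and pm: "\<not> p dvd m"
  shows "multiplicity p (a ^ m - 1) = multiplicity p (a ^ d - 1)"
proof -
  obtain e where e: "m = d * e" using d by blast
  define b where "b = a ^ d"
  have d0: "d > 0" "e > 0" using e d by auto
  have b: "b > 1" unfolding b_def using a d0 by (intro one_less_power) auto
  have "[b = 1] (mod p)" using pd b unfolding b_def[symmetric]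
    by (metis cong_altdef_nat less_imp_le)
  then have "[(\<Sum>i<e. b ^ i) = (\<Sum>i<e. 1 ^ i)] (mod p)"
    by (intro cong_sum cong_pow)
  then have "[(\<Sum>i<e. b ^ i) = e] (mod p)" by simp
  moreover have "\<not> p dvd e" using pm e by auto
  ultimately have ns: "\<not> p dvd (\<Sum>i<e. b ^ i)" using cong_dvd_iff by blast
  have "int (b ^ e - 1) = int ((b - 1) * (\<Sum>i<e. b ^ i))"
    using b power_diff_1_eq[of "int b" e] by (simp add: of_nat_diff)
  then have "a ^ m - 1 = (b - 1) * (\<Sum>i<e. b ^ i)"
    by (simp only: of_nat_eq_iff b_def e power_mult)
  moreover have "(\<Sum>i<e. b ^ i) \<noteq> 0" using ns by (metis dvd_0_right)
  ultimately have "multiplicity p (a ^ m - 1) = multiplicity p (b - 1) + multiplicity p (\<Sum>i<e. b ^ i)"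
    using b p by (simp add: prime_elem_multiplicity_mult_distrib)
  then show ?thesis using ns by (simp add: not_dvd_imp_multiplicity_0 b_def)
qed

text \<open>
  By Moebius inversion the \<open>n\<close>-th cyclotomic polynomial at \<open>n\<close> is the product of
  \<open>f S = n ^ (n / \<Prod>S) - 1\<close>, to the power \<open>(-1) ^ card S\<close>, over all subsets \<open>S\<close> of
  the set \<open>P\<close> of prime divisors of \<open>n\<close>.  If no prime is \<open>1\<close> modulo \<open>n\<close>, then no prime \<open>p\<close> gives \<open>n\<close> the order \<open>n\<close> modulo \<open>p\<close>;
  for each \<open>p\<close> the sets \<open>S\<close> with \<open>p dvd f S\<close> are then all subsets of a nonempty set \<open>U\<close> (or there
  are none), all with the same multiplicity, and the contributions of even and odd \<open>S\<close> cancel.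
  So the even and the odd product coincide.  With \<open>b = n ^ (n / \<Prod>P)\<close> every \<open>f S\<close> is
  \<open>-1\<close> modulo \<open>b ^ 2\<close>, except that \<open>f P = b - 1\<close>; as both products have equally many factors, \<open>b ^ 2\<close>
  divides \<open>b\<close>, which is absurd.
\<close>
lemma exists_prime_cong_1:
  fixes n :: nat
  assumes n: "n \<ge> 2"
  shows "\<exists>p. prime p \<and> [p = 1] (mod n)"
proof (rule ccontr)
  assume neg: "\<not> ?thesis"
  define P where "P = prime_factors n"
  have P: "finite P" "P \<noteq> {}" "\<And>q. q \<in> P \<Longrightarrow> prime q"
    using n prime_factor_nat[of n] by (auto simp: P_def prime_factors_dvd)
  have dvdn: "\<Prod>S dvd n" if "S \<subseteq> P" for S
    using that finite_subset[OF that P(1)] P(3)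
    by (subst prod_dvd_iff_primes) (auto simp: P_def)
  define f where "f S = n ^ (n div \<Prod>S) - 1" for S
  have div_pos: "n div \<Prod>S > 0" "n div \<Prod>S dvd n" if "S \<subseteq> P" for S
    using dvdn[OF that] n by (auto simp: dvd_div_eq_0_iff div_dvd_iff_mult intro!: Nat.gr0I) 
  have f0: "f S > 0" if "S \<subseteq> P" for S
    using one_less_power[of n "n div \<Prod>S"] div_pos[OF that] n unfolding f_def by simp
  have fin: "finite {S \<in> Pow P. Q S}" for Q using P by auto
  have "(\<Prod>S | S \<in> Pow P \<and> even (card S). f S) = (\<Prod>S | S \<in> Pow P \<and> odd (card S). f S)"
  proof (rule multiplicity_eq_nat)
    fix p :: nat assume p: "prime p"
    define d where "d = ord p n"
    define v where "v = multiplicity p (n ^ d - 1)"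
    define U where "U = {q \<in> P. d * q dvd n}"
    have dvd_iff: "p dvd n ^ m - 1 \<longleftrightarrow> d dvd m" for m
    proof -
      have "[n ^ m = 1] (mod p) \<longleftrightarrow> p dvd n ^ m - 1"
        using n by (metis cong_altdef_nat' cong_sym_eq cong_to_1_nat diff_is_0_eq' dvd_0_right nat_le_linear one_le_power cong_diff_iff_cong_0_nat cong_0_iff le_trans one_le_numeral)
      then show ?thesis unfolding d_def ord_divides by simp
    qed
    have mult: "multiplicity p (f S) = (if d dvd n \<and> S \<subseteq> U then v else 0)" if S: "S \<subseteq> P" for S
    proof -
      have finS: "finite S" "\<And>q. q \<in> S \<Longrightarrow> prime q" using S P finite_subset by auto
      have "d dvd n div \<Prod>S \<longleftrightarrow> d * \<Prod>S dvd n"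
        using dvdn[OF S] n div_pos[OF S] by (intro dvd_div_iff_mult) (auto intro!: Nat.gr0I)
      also have "\<dots> \<longleftrightarrow> d dvd n \<and> S \<subseteq> U"
      proof (cases "d dvd n")
        case True
        then obtain k where k: "n = d * k" by blast
        then have "d > 0" using n by (auto intro!: Nat.gr0I)
        have "d * \<Prod>S dvd n \<longleftrightarrow> (\<forall>q\<in>S. q dvd k)"
          using prod_dvd_iff_primes[OF finS, of k] \<open>d > 0\<close> by (simp add: k)
        also have "\<dots> \<longleftrightarrow> S \<subseteq> U" using S \<open>d > 0\<close> by (auto simp: U_def k)
        finally show ?thesis using True by simp
      qed (auto dest: dvd_mult_left)
      finally have iff: "d dvd n div \<Prod>S \<longleftrightarrow> d dvd n \<and> S \<subseteq> U" .
      show ?thesis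
      proof (cases "d dvd n div \<Prod>S")
        case True
        have "p dvd n ^ d - 1" unfolding dvd_iff by simp
        moreover have "d \<noteq> 0" using True div_pos[OF S] by (intro notI) simp
        then have "coprime p n" by (auto simp: d_def ord_eq_0)
        then have "\<not> p dvd n div \<Prod>S"
          using p div_pos(2)[OF S] by (meson coprime_absorb_left dvd_trans not_prime_unit)
        ultimately have "multiplicity p (f S) = v"
          unfolding f_def v_def using p n True div_pos[OF S]
          by (intro multiplicity_power_minus_1) auto
        then show ?thesis using True iff by simp
      next
        case False
        then have "\<not> p dvd f S" unfolding f_def dvd_iff .
        then show ?thesis using False iff not_dvd_imp_multiplicity_0 by auto
      qed
    qed
    have mult_prod: "multiplicity p (\<Prod>S | S \<in> Pow P \<and> Q S. f S)
        = (if d dvd n then v * card {S. S \<subseteq> U \<and> Q S} else 0)" for Q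
    proof -
      have nz: "0 \<notin> f ` {S \<in> Pow P. Q S}"
      proof
        assume "0 \<in> f ` {S \<in> Pow P. Q S}"
        then obtain S where "S \<subseteq> P" "f S = 0" by auto
        then show False using f0[of S] by simp
      qed
      have "multiplicity p (\<Prod>S | S \<in> Pow P \<and> Q S. f S) = (\<Sum>S | S \<in> Pow P \<and> Q S. multiplicity p (f S))"
        using prime_elem_multiplicity_prod_distrib[OF _ nz fin] p by (simp add: prime_imp_prime_elem)
      also have "\<dots> = (\<Sum>S | S \<in> Pow P \<and> Q S. if d dvd n \<and> S \<subseteq> U then v else 0)"
        by (intro sum.cong refl mult) auto
      also have "\<dots> = (\<Sum>S | S \<subseteq> U \<and> Q S. if d dvd n then v else 0)"
        using fin by (intro sum.mono_neutral_cong_right) (auto simp: U_def)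
      finally show ?thesis by simp
    qed
    show "multiplicity p (\<Prod>S | S \<in> Pow P \<and> even (card S). f S)
        = multiplicity p (\<Prod>S | S \<in> Pow P \<and> odd (card S). f S)"
    proof (cases "d dvd n")
      case True
      then obtain k where k: "n = d * k" by blast
      have "d * k > 0" using k n by linarith
      then have dk: "d \<noteq> 0" "k \<noteq> 0" by auto
      then have "coprime p n" using ord_eq_0[of p n] by (simp add: d_def)
      then have "d dvd p - 1" unfolding d_def
        using order_divides_totient[of p n] p by (simp add: totient_prime)
      \<comment> \<open>By Fermat's little theorem, \<open>d = n\<close> would make \<open>p\<close> congruent to \<open>1\<close> modulo \<open>n\<close>.\<close>
      then have "d \<noteq> n" using neg p
        by (metis cong_to_1'_nat cong_altdef_nat' cong_diff_iff_cong_0_nat cong_0_iff prime_ge_1_nat)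
      then have "k \<noteq> 1" using k by auto
      then obtain q where q: "prime q" "q dvd k" using prime_factor_nat by blast
      then have "q \<in> U" using dk unfolding U_def P_def by (auto simp: k in_prime_factors_iff)
      moreover have "finite U" using P by (simp add: U_def)
      ultimately have "card {S. S \<subseteq> U \<and> even (card S)} = card {S. S \<subseteq> U \<and> odd (card S)}"
        using card_subsupersets_even_odd[of U "{}"] by auto
      then show ?thesis unfolding mult_prod by simp
    next
      case False
      then show ?thesis unfolding mult_prod by simp
    qed
  qed (use f0 in \<open>auto intro!: prod_pos\<close>)
  then have prod_eq: "(\<Prod>S | S \<in> Pow P \<and> even (card S) = e. f S) = (\<Prod>S | S \<in> Pow P \<and> even (card S) = (\<not> e). f S)" for e
    by (cases e) simp_all
  have card_eq: "card {S \<in> Pow P. even (card S) = e} = card {S \<in> Pow P. even (card S) = (\<not> e)}" for e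
  proof -
    have "{} \<subset> P" using P(2) by blast
    from card_subsupersets_even_odd[OF P(1) this] show ?thesis by (cases e) simp_all
  qed
  define b where "b = int (n ^ (n div \<Prod>P))"
  have b: "b \<ge> 2"
  proof -
    have "n ^ 1 \<le> n ^ (n div \<Prod>P)" using n div_pos[of P] by (intro power_increasing) auto
    then have "int (n ^ 1) \<le> b" unfolding b_def of_nat_le_iff .
    then show ?thesis using n by simp
  qed
  have fb: "int (f S) = b ^ \<Prod>(P - S) - 1" if S: "S \<subseteq> P" for S
  proof -
    have PS: "\<Prod>P = \<Prod>(P - S) * \<Prod>S" using S P(1) by (rule prod.subset_diff)
    obtain c where c: "n = \<Prod>P * c" using dvdn[of P] by auto
    have pos: "\<Prod>P > 0" "\<Prod>S > 0"
      using P(3) S by (auto intro!: prod_pos dest: prime_gt_0_nat)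
    have "n div \<Prod>P = c" using c pos by simp
    moreover have "n div \<Prod>S = c * \<Prod>(P - S)" using c pos unfolding PS by simp
    ultimately have "n div \<Prod>S = n div \<Prod>P * \<Prod>(P - S)" by simp
    then have "int (n ^ (n div \<Prod>S)) = b ^ \<Prod>(P - S)" by (simp add: b_def power_mult)
    then show ?thesis using n by (simp add: f_def of_nat_diff)
  qed
  have f_cong: "[int (f S) = -1] (mod b\<^sup>2)" if S: "S \<subseteq> P" "S \<noteq> P" for S
  proof -
    from S obtain q where q: "q \<in> P - S" by blast
    have "q dvd \<Prod>(P - S)" using q P(1) by (intro dvd_prodI) auto
    moreover have "\<Prod>(P - S) > 0" using P by (auto intro!: prod_pos prime_gt_0_nat)
    moreover have "q \<ge> 2" using q P by (auto intro: prime_ge_2_nat)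
    ultimately have "2 \<le> \<Prod>(P - S)" by (meson dvd_imp_le le_trans)
    then have "b\<^sup>2 dvd b ^ \<Prod>(P - S)" by (rule le_imp_power_dvd)
    then show ?thesis using fb[OF S(1)] by (simp add: cong_iff_dvd_diff)
  qed
  define c where "c = card {S \<in> Pow P. even (card S) = odd (card P)}"
  have "[int (\<Prod>S | S \<in> Pow P \<and> even (card S) = odd (card P). f S) = (\<Prod>S | S \<in> Pow P \<and> even (card S) = odd (card P). -1)] (mod b\<^sup>2)"
    unfolding of_nat_prod by (intro cong_prod f_cong) auto
  then have other: "[int (\<Prod>S | S \<in> Pow P \<and> even (card S) = odd (card P). f S) = (-1) ^ c] (mod b\<^sup>2)"
    by (simp add: c_def)
  \<comment> \<open>The parity class that contains the exceptional factor \<open>f P\<close>.\<close>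
  define K where "K = {S \<in> Pow P. even (card S) = even (card P)}"
  have K: "finite K" "P \<in> K" "card K = c" using fin card_eq[of "even (card P)"] by (auto simp: K_def c_def)
  have "int (\<Prod>S\<in>K. f S) = (b - 1) * (\<Prod>S\<in>K - {P}. int (f S))"
    using K fb[of P] by (simp add: prod.remove)
  moreover have "[(\<Prod>S\<in>K - {P}. int (f S)) = (\<Prod>S\<in>K - {P}. -1)] (mod b\<^sup>2)"
    by (intro cong_prod f_cong) (auto simp: K_def)
  then have "[(\<Prod>S\<in>K - {P}. int (f S)) = (-1) ^ (c - 1)] (mod b\<^sup>2)"
    using K by simp
  ultimately have "[int (\<Prod>S\<in>K. f S) = (b - 1) * (-1) ^ (c - 1)] (mod b\<^sup>2)"
    by (simp add: cong_mult)
  moreover have "(\<Prod>S\<in>K. f S) = (\<Prod>S | S \<in> Pow P \<and> even (card S) = odd (card P). f S)"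
    using prod_eq[of "even (card P)"] by (simp add: K_def)
  ultimately have "[(b - 1) * (-1) ^ (c - 1) = (-1) ^ c] (mod b\<^sup>2)"
    using other cong_sym cong_trans by metis
  moreover have "c > 0" using K card_gt_0_iff by blast
  ultimately have "b\<^sup>2 dvd (-1) ^ (c - 1) * b"
    by (simp add: cong_iff_dvd_diff power_eq_if[of "-1" c] algebra_simps)
  then have "b\<^sup>2 dvd b" by (cases "even (c - 1)") simp_all
  then have "b\<^sup>2 \<le> b" using b by (intro zdvd_imp_le) auto
  then show False using b by (simp add: power2_eq_square)
qed

section \<open>Selberg's upper bound sieve\<close>

text \<open>
  The cancellation behind Moebius inversion in the lattice of subsets of \<open>H\<close>.
\<close>
lemma sum_alternating_supersets:
  assumes "finite H" "C \<subseteq> H"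
  shows "(\<Sum>A | A \<subseteq> H \<and> C \<subseteq> A. (-1) ^ card A) = (if C = H then (-1) ^ card H else (0 :: real))"
proof (cases "C = H")
  case True
  then have "{A. A \<subseteq> H \<and> C \<subseteq> A} = {H}" by auto
  then show ?thesis using True by simp
next
  case False
  then have "C \<subset> H" using assms by auto
  from card_subsupersets_even_odd[OF assms(1) this] have
    "card {x \<in> {A. A \<subseteq> H \<and> C \<subseteq> A}. even (card x)} = card {x \<in> {A. A \<subseteq> H \<and> C \<subseteq> A}. odd (card x)}"
    by (simp add: conj_assoc)
  from sum_alternating_cancels[OF _ this] show ?thesis using assms False by simp
qed

lemma sum_common_subset_swap:
  fixes F :: "'a set \<Rightarrow> 'a set \<Rightarrow> 'a set \<Rightarrow> real"
  assumes "finite D"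
  shows "(\<Sum>A\<in>D. \<Sum>B\<in>D. \<Sum>C | C \<in> D \<and> C \<subseteq> A \<and> C \<subseteq> B. F A B C)
       = (\<Sum>C\<in>D. \<Sum>A | A \<in> D \<and> C \<subseteq> A. \<Sum>B | B \<in> D \<and> C \<subseteq> B. F A B C)"
proof -
  have "(\<Sum>A\<in>D. \<Sum>B\<in>D. \<Sum>C | C \<in> D \<and> C \<subseteq> A \<and> C \<subseteq> B. F A B C)
      = (\<Sum>A\<in>D. \<Sum>B\<in>D. \<Sum>C | C \<in> {C \<in> D. C \<subseteq> A} \<and> C \<subseteq> B. F A B C)"
    by (simp add: conj_assoc)
  also have "\<dots> = (\<Sum>A\<in>D. \<Sum>C | C \<in> D \<and> C \<subseteq> A. \<Sum>B | B \<in> D \<and> C \<subseteq> B. F A B C)"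
  proof (rule sum.cong[OF refl])
    fix A
    have "finite {C \<in> D. C \<subseteq> A}" using assms by auto
    from sum.swap_restrict[OF assms this, of "F A" "\<lambda>B C. C \<subseteq> B"]
    show "(\<Sum>B\<in>D. \<Sum>C | C \<in> {C \<in> D. C \<subseteq> A} \<and> C \<subseteq> B. F A B C)
        = (\<Sum>C | C \<in> D \<and> C \<subseteq> A. \<Sum>B | B \<in> D \<and> C \<subseteq> B. F A B C)" .
  qed
  also have "\<dots> = (\<Sum>C\<in>D. \<Sum>A | A \<in> D \<and> C \<subseteq> A. \<Sum>B | B \<in> D \<and> C \<subseteq> B. F A B C)"
    by (rule sum.swap_restrict[OF assms assms])
  finally show ?thesis .
qed

text \<open>
  Write \<open>W A\<close> for the product of \<open>w\<close> over \<open>A\<close>.  For any real weights \<open>lam\<close> on \<open>D\<close> with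
  \<open>lam {} = 1\<close>, the square of the sum of \<open>lam A\<close> over the \<open>A \<in> D\<close> such that \<open>n\<close> lies in \<open>E p\<close>
  for all \<open>p \<in> A\<close> is nonnegative, and it is \<open>1\<close> at every \<open>n\<close> that survives the sieve.  Summing
  over \<open>n\<close> gives \<open>X\<close> times the quadratic form with entries \<open>lam A * lam B / W (A \<union> B)\<close>, plus an
  error of at most the square of the sum of \<open>\<bar>lam A\<bar>\<close>.  Since \<open>W (A \<inter> B)\<close> is the sum of
  \<open>phi C\<close>, the product of \<open>w p - 1\<close> over \<open>C\<close>, taken over the common subsets \<open>C\<close>, the form is
  diagonal in the variables \<open>y C\<close>, the sum of \<open>lam A / W A\<close> over \<open>A \<supseteq> C\<close>, with coefficients
  \<open>phi C\<close>.  Its minimum is at \<open>y C\<close> proportional to \<open>(-1) ^ card C / phi C\<close>.  Taking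
  \<open>y C\<close> proportional to \<open>(-1) ^ card C / W C\<close> instead makes the value at most the reciprocal of
  the sum of \<open>1 / W A\<close>; for sets of primes with \<open>w p = p\<close> this is part of the harmonic series
  and thus easy to bound from below.
\<close>
theorem selberg_sieve:
  fixes w :: "'p \<Rightarrow> real" and E :: "'p \<Rightarrow> 'n set"
  assumes D: "finite D" "{} \<in> D" "\<And>A B. A \<in> D \<Longrightarrow> B \<subseteq> A \<Longrightarrow> B \<in> D"
    and finD: "\<And>A. A \<in> D \<Longrightarrow> finite A"
    and w: "\<And>A p. A \<in> D \<Longrightarrow> p \<in> A \<Longrightarrow> w p \<ge> 1"
    and S: "finite S" and X: "X \<ge> 0"
    and count: "\<And>A B. A \<in> D \<Longrightarrow> B \<in> D \<Longrightarrow>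
       \<bar>real (card {n \<in> S. \<forall>p \<in> A \<union> B. n \<in> E p}) - X / (\<Prod>p\<in>A \<union> B. w p)\<bar> \<le> 1"
  shows "real (card {n \<in> S. \<forall>p \<in> \<Union>D. n \<notin> E p})
           \<le> X / (\<Sum>A\<in>D. 1 / prod w A) + (\<Sum>A\<in>D. prod w A)\<^sup>2"
proof -
  define W where "W = prod w"
  define G where "G = (\<Sum>A\<in>D. 1 / W A)"
  \<comment> \<open>The weights obtained from \<open>y H = (-1) ^ card H / (G * W H)\<close> by inversion.\<close>
  define lam where "lam A = (-1) ^ card A * (W A / G) * (\<Sum>H | H \<in> D \<and> A \<subseteq> H. 1 / W H)" for A
  have W1: "W A \<ge> 1" if "A \<in> D" for A
    unfolding W_def using w[OF that] by (intro prod_ge_1) auto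
  have W0: "W A > 0" if "A \<in> D" for A using W1[OF that] by simp
  have "1 / W {} \<le> G" unfolding G_def
    using D W0 by (intro member_le_sum) (auto intro: less_imp_le)
  then have G: "G > 0" by (simp add: W_def)
  have lam_empty: "lam {} = 1"
    using G by (simp add: lam_def W_def G_def)
  have lam_le: "\<bar>lam A\<bar> \<le> W A" if A: "A \<in> D" for A
  proof -
    have "(\<Sum>H | H \<in> D \<and> A \<subseteq> H. 1 / W H) \<le> G" unfolding G_def
      using D W0 by (intro sum_mono2) (auto intro: less_imp_le)
    moreover have "(\<Sum>H | H \<in> D \<and> A \<subseteq> H. 1 / W H) \<ge> 0"
      using W0 by (intro sum_nonneg) (auto intro: less_imp_le)
    ultimately have "\<bar>\<Sum>H | H \<in> D \<and> A \<subseteq> H. 1 / W H\<bar> \<le> G" by simp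
    then have "W A / G * \<bar>\<Sum>H | H \<in> D \<and> A \<subseteq> H. 1 / W H\<bar> \<le> W A / G * G"
      using G W0[OF A] by (intro mult_left_mono) auto
    then show ?thesis using G W0[OF A] unfolding lam_def by (simp add: abs_mult)
  qed
  \<comment> \<open>The inversion: this is the value of the diagonal variable \<open>y C\<close>.\<close>
  have diag: "(\<Sum>A | A \<in> D \<and> C \<subseteq> A. lam A / W A) = (-1) ^ card C / (G * W C)" if C: "C \<in> D" for C
  proof -
    have "(\<Sum>A | A \<in> D \<and> C \<subseteq> A. lam A / W A)
        = (\<Sum>A | A \<in> D \<and> C \<subseteq> A. \<Sum>H | H \<in> D \<and> A \<subseteq> H. (-1) ^ card A / (G * W H))"
    proof (intro sum.cong refl)
      fix A assume "A \<in> {A \<in> D. C \<subseteq> A}"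
      then have "W A \<noteq> 0" using W0[of A] by auto
      then have "lam A / W A = (-1) ^ card A / G * (\<Sum>H | H \<in> D \<and> A \<subseteq> H. 1 / W H)"
        by (simp add: lam_def)
      then show "lam A / W A = (\<Sum>H | H \<in> D \<and> A \<subseteq> H. (-1) ^ card A / (G * W H))"
        by (simp add: sum_distrib_left)
    qed
    also have "\<dots> = (\<Sum>H\<in>D. \<Sum>A | A \<in> {A \<in> D. C \<subseteq> A} \<and> A \<subseteq> H. (-1) ^ card A / (G * W H))"
      using D(1) by (subst sum.swap_restrict) auto
    also have "\<dots> = (\<Sum>H\<in>D. if H = C then (-1) ^ card C / (G * W C) else 0)"
    proof (intro sum.cong refl)
      fix H assume H: "H \<in> D"
      have eq: "{A \<in> {A \<in> D. C \<subseteq> A}. A \<subseteq> H} = {A. A \<subseteq> H \<and> C \<subseteq> A}"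
        using D(3)[OF H] by auto
      show "(\<Sum>A | A \<in> {A \<in> D. C \<subseteq> A} \<and> A \<subseteq> H. (-1) ^ card A / (G * W H))
            = (if H = C then (-1) ^ card C / (G * W C) else 0)"
      proof (cases "C \<subseteq> H")
        case True
        show ?thesis unfolding eq sum_divide_distrib[symmetric]
          using sum_alternating_supersets[OF finD[OF H] True] by auto
      next
        case False
        then have emp: "{A. A \<subseteq> H \<and> C \<subseteq> A} = {}" and "H \<noteq> C" by auto
        then show ?thesis unfolding eq emp by simp
      qed
    qed
    also have "\<dots> = (-1) ^ card C / (G * W C)" using C D(1) by simp
    finally show ?thesis .
  qed
  have W_Int: "W (A \<union> B) * W (A \<inter> B) = W A * W B" if "A \<in> D" "B \<in> D" for A B
    unfolding W_def using finD that by (intro prod.union_inter) auto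
  have UnW0: "W (A \<union> B) > 0" if "A \<in> D" "B \<in> D" for A B
    unfolding W_def using w that by (intro prod_pos) (force intro: less_le_trans[of 0 1])
  define phi where "phi C = (\<Prod>p\<in>C. w p - 1)" for C
  have phi: "0 \<le> phi C" "phi C \<le> W C" if "C \<in> D" for C
    unfolding phi_def W_def using w[OF that] by (auto intro!: prod_nonneg prod_mono)
  have W_phi: "W A = (\<Sum>C | C \<in> D \<and> C \<subseteq> A. phi C)" if A: "A \<in> D" for A
  proof -
    have "W A = (\<Prod>p\<in>A. (w p - 1) + 1)" by (simp add: W_def)
    also have "\<dots> = (\<Sum>C\<in>Pow A. phi C)"
      unfolding phi_def by (subst prod_add[OF finD[OF A]]) simp
    also have "Pow A = {C. C \<in> D \<and> C \<subseteq> A}" using D(3)[OF A] by auto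
    finally show ?thesis .
  qed
  have main: "(\<Sum>A\<in>D. \<Sum>B\<in>D. lam A * lam B / W (A \<union> B)) \<le> 1 / G"
  proof -
    have "(\<Sum>A\<in>D. \<Sum>B\<in>D. lam A * lam B / W (A \<union> B))
        = (\<Sum>A\<in>D. \<Sum>B\<in>D. \<Sum>C | C \<in> D \<and> C \<subseteq> A \<and> C \<subseteq> B. phi C * (lam A / W A) * (lam B / W B))"
    proof (intro sum.cong refl)
      fix A B assume AB: "A \<in> D" "B \<in> D"
      have "A \<inter> B \<in> D" using D(3)[OF AB(1)] by auto
      have "1 / W (A \<union> B) = W (A \<inter> B) / (W A * W B)"
        using W_Int[OF AB] UnW0[OF AB] W0[OF AB(1)] W0[OF AB(2)] by (simp add: field_simps)
      then have "lam A * lam B / W (A \<union> B) = W (A \<inter> B) * ((lam A / W A) * (lam B / W B))"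
        by (metis (no_types, opaque_lifting) mult.commute mult.right_neutral times_divide_eq_right times_divide_times_eq)
      also have "\<dots> = (\<Sum>C | C \<in> D \<and> C \<subseteq> A \<and> C \<subseteq> B. phi C * (lam A / W A) * (lam B / W B))"
        by (simp only: W_phi[OF \<open>A \<inter> B \<in> D\<close>] sum_distrib_right Int_subset_iff mult.assoc)
      finally show "lam A * lam B / W (A \<union> B) = \<dots>" .
    qed
    also have "\<dots> = (\<Sum>C\<in>D. \<Sum>A | A \<in> D \<and> C \<subseteq> A. \<Sum>B | B \<in> D \<and> C \<subseteq> B.
                       phi C * (lam A / W A) * (lam B / W B))"
      by (rule sum_common_subset_swap[OF D(1)])
    also have "\<dots> = (\<Sum>C\<in>D. phi C * (\<Sum>A | A \<in> D \<and> C \<subseteq> A. lam A / W A)\<^sup>2)"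
    proof (rule sum.cong[OF refl])
      fix C
      define u where "u A = lam A / W A" for A
      show "(\<Sum>A | A \<in> D \<and> C \<subseteq> A. \<Sum>B | B \<in> D \<and> C \<subseteq> B. phi C * (lam A / W A) * (lam B / W B))
          = phi C * (\<Sum>A | A \<in> D \<and> C \<subseteq> A. lam A / W A)\<^sup>2"
        unfolding u_def[symmetric] power2_eq_square sum_product by (simp add: sum_distrib_left mult.assoc del: sum_product)
    qed
    also have "\<dots> = (\<Sum>C\<in>D. phi C / (G * W C)\<^sup>2)"
      by (intro sum.cong refl) (simp add: diag power_divide flip: power_mult)
    also have "\<dots> \<le> (\<Sum>C\<in>D. W C / (G * W C)\<^sup>2)"
      using phi by (intro sum_mono divide_right_mono) auto
    also have "\<dots> = (\<Sum>C\<in>D. 1 / W C / G\<^sup>2)"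
    proof (rule sum.cong[OF refl])
      fix C assume "C \<in> D"
      from W0[OF this] show "W C / (G * W C)\<^sup>2 = 1 / W C / G\<^sup>2"
        by (simp add: power2_eq_square)
    qed
    also have "\<dots> = 1 / G"
      unfolding sum_divide_distrib[symmetric] G_def[symmetric] using G by (simp add: power2_eq_square)
    finally show ?thesis .
  qed
  define T where "T n = {A \<in> D. \<forall>p\<in>A. n \<in> E p}" for n
  have "real (card {n \<in> S. \<forall>p \<in> \<Union>D. n \<notin> E p}) = (\<Sum>n\<in>{n \<in> S. \<forall>p \<in> \<Union>D. n \<notin> E p}. (\<Sum>A\<in>T n. lam A)\<^sup>2)"
  proof -
    have "T n = {{}}" if "\<forall>p \<in> \<Union>D. n \<notin> E p" for n
      using that D(2) by (auto simp: T_def)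
    then show ?thesis by (simp add: lam_empty)
  qed
  also have "\<dots> \<le> (\<Sum>n\<in>S. (\<Sum>A\<in>T n. lam A)\<^sup>2)"
    using S by (intro sum_mono2) auto
  also have "\<dots> = (\<Sum>n\<in>S. \<Sum>A\<in>D. \<Sum>B\<in>D. if \<forall>p\<in>A \<union> B. n \<in> E p then lam A * lam B else 0)"
  proof (intro sum.cong refl)
    fix n
    have "(\<Sum>A\<in>T n. lam A) = (\<Sum>A\<in>D. if \<forall>p\<in>A. n \<in> E p then lam A else 0)"
      unfolding T_def using D(1) by (intro sum.inter_filter)
    then show "(\<Sum>A\<in>T n. lam A)\<^sup>2 = (\<Sum>A\<in>D. \<Sum>B\<in>D. if \<forall>p\<in>A \<union> B. n \<in> E p then lam A * lam B else 0)"
      by (auto simp: power2_eq_square sum_product intro!: sum.cong)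
  qed
  also have "\<dots> = (\<Sum>A\<in>D. \<Sum>B\<in>D. \<Sum>n\<in>S. if \<forall>p\<in>A \<union> B. n \<in> E p then lam A * lam B else 0)"
    by (subst sum.swap, subst (2) sum.swap) simp
  also have "\<dots> = (\<Sum>A\<in>D. \<Sum>B\<in>D. lam A * lam B * real (card {n \<in> S. \<forall>p \<in> A \<union> B. n \<in> E p}))"
    using S by (simp add: sum.inter_filter[symmetric] mult.commute)
  also have "\<dots> \<le> (\<Sum>A\<in>D. \<Sum>B\<in>D. X * (lam A * lam B / W (A \<union> B)) + W A * W B)"
  proof (intro sum_mono)
    fix A B assume AB: "A \<in> D" "B \<in> D"
    define c where "c = real (card {n \<in> S. \<forall>p \<in> A \<union> B. n \<in> E p})"
    have "lam A * lam B * (c - X / W (A \<union> B)) \<le> \<bar>lam A * lam B * (c - X / W (A \<union> B))\<bar>"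
      by (rule abs_ge_self)
    also have "\<dots> = \<bar>lam A\<bar> * \<bar>lam B\<bar> * \<bar>c - X / W (A \<union> B)\<bar>"
      by (simp add: abs_mult)
    also have "\<dots> \<le> W A * W B * 1"
      using lam_le AB W0 count[OF AB] unfolding c_def W_def
      by (intro mult_mono) (auto intro!: mult_nonneg_nonneg less_imp_le simp: W_def)
    finally show "lam A * lam B * c \<le> X * (lam A * lam B / W (A \<union> B)) + W A * W B"
      by (simp add: algebra_simps)
  qed
  also have "\<dots> = X * (\<Sum>A\<in>D. \<Sum>B\<in>D. lam A * lam B / W (A \<union> B)) + (\<Sum>A\<in>D. W A)\<^sup>2"
    by (simp only: sum.distrib sum_product power2_eq_square) (simp only: sum_distrib_left)
  also have "\<dots> \<le> X * (1 / G) + (\<Sum>A\<in>D. W A)\<^sup>2"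
    using main X by (intro add_right_mono mult_left_mono) auto
  finally show ?thesis by (simp add: G_def W_def)
qed

section \<open>Squarefree sieving moduli coprime to k\<close>

text \<open>
  The squarefree numbers up to \<open>z\<close> that are coprime to \<open>k\<close>, each represented by its set of prime
  divisors.
\<close>
definition sieve_family :: "nat \<Rightarrow> nat \<Rightarrow> nat set set" where
  "sieve_family k z = {A. finite A \<and> (\<forall>p\<in>A. prime p \<and> \<not> p dvd k) \<and> \<Prod>A \<le> z}"

lemma sieve_family_prod_pos: "A \<in> sieve_family k z \<Longrightarrow> \<Prod>A > 0"
  by (auto simp: sieve_family_def intro!: prod_pos prime_gt_0_nat)

lemma sieve_family_subset:
  assumes A: "A \<in> sieve_family k z" and B: "B \<subseteq> A"
  shows "B \<in> sieve_family k z"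
proof -
  have "\<Prod>B dvd \<Prod>A" using A B by (intro prod_dvd_prod_subset) (auto simp: sieve_family_def)
  then have "\<Prod>B \<le> \<Prod>A" using sieve_family_prod_pos[OF A] by (rule dvd_imp_le)
  then show ?thesis using A B by (auto simp: sieve_family_def intro: finite_subset)
qed

lemma finite_sieve_family: "finite (sieve_family k z)"
proof -
  have "A \<subseteq> {..z}" if "A \<in> sieve_family k z" for A
  proof
    fix p assume "p \<in> A"
    then have "{p} \<in> sieve_family k z" using sieve_family_subset[OF that] by simp
    then show "p \<in> {..z}" by (simp add: sieve_family_def)
  qed
  then have "sieve_family k z \<subseteq> Pow {..z}" by auto
  then show ?thesis by (rule finite_subset) simp
qed

text \<open>
  The products are distinct positive integers up to \<open>z\<close>.
\<close>
lemma sum_prod_sieve_family_le: "(\<Sum>A\<in>sieve_family k z. \<Prod>A) \<le> z\<^sup>2"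
proof -
  have "inj_on Prod (sieve_family k z)"
  proof (rule inj_onI)
    fix A B assume AB: "A \<in> sieve_family k z" "B \<in> sieve_family k z" "\<Prod>A = \<Prod>B"
    have "A = {p. prime p \<and> p dvd \<Prod>A}" "B = {p. prime p \<and> p dvd \<Prod>B}"
      using AB by (intro prime_divisors_prod_primes[symmetric]; simp add: sieve_family_def)+
    then show "A = B" unfolding AB(3) by (rule trans[OF _ sym])
  qed
  then have "(\<Sum>A\<in>sieve_family k z. \<Prod>A) = (\<Sum>m\<in>Prod ` sieve_family k z. m)"
    by (simp add: sum.reindex)
  also have "\<dots> \<le> (\<Sum>m\<in>{1..z}. m)"
  proof (rule sum_mono2)
    show "Prod ` sieve_family k z \<subseteq> {1..z}"
    proof
      fix m assume "m \<in> Prod ` sieve_family k z"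
      then obtain A where A: "A \<in> sieve_family k z" "m = \<Prod>A" by blast
      then have "m \<le> z" by (simp add: sieve_family_def)
      moreover have "m > 0" unfolding A(2) by (rule sieve_family_prod_pos[OF A(1)])
      ultimately show "m \<in> {1..z}" by simp
    qed
  qed auto
  also have "\<dots> \<le> (\<Sum>m\<in>{1..z}. z)" by (intro sum_mono) auto
  finally show ?thesis by (simp add: power2_eq_square)
qed

text \<open>
  This is \<open>\<sigma>(k) / k\<close>, with \<open>\<sigma>\<close> the sum-of-divisors function.
\<close>
definition divisor_recip_sum :: "nat \<Rightarrow> real" where
  "divisor_recip_sum k = (\<Sum>d | d dvd k. 1 / real d)"

lemma sum_inverse_squares_le: "(\<Sum>s=1..z. 1 / (real s)\<^sup>2) \<le> 2"
proof -
  have "(\<Sum>s=1..z. 1 / (real s)\<^sup>2) \<le> 2 - 1 / real z" if "z > 0"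
    using that
  proof (induction z rule: nat_induct_non_zero)
    case (Suc z)
    have "1 / (real z + 1)\<^sup>2 \<le> 1 / real z - 1 / (real z + 1)"
    proof -
      have "1 / (real z + 1)\<^sup>2 \<le> 1 / (real z * (real z + 1))"
        using Suc.hyps by (intro divide_left_mono) (auto simp: power2_eq_square)
      also have "\<dots> = 1 / real z - 1 / (real z + 1)"
        using Suc.hyps by (simp add: field_simps)
      finally show ?thesis .
    qed
    then show ?case using Suc by (simp add: add.commute)
  qed simp
  then show ?thesis by (cases "z = 0") (auto intro: order_trans)
qed

lemma squarefree_eq_prod_primes:
  fixes m :: nat
  assumes "squarefree m"
  shows "m = \<Prod>{p. prime p \<and> p dvd m}"
proof -
  have m: "m > 0" using assms by (auto intro!: Nat.gr0I)
  have eq: "prime_factors m = {p. prime p \<and> p dvd m}"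
    using m by (auto simp: prime_factors_dvd)
  have "m = (\<Prod>p\<in>prime_factors m. p ^ multiplicity p m)"
    using m by (rule prime_factorization_nat)
  also have "\<dots> = \<Prod>(prime_factors m)"
  proof (intro prod.cong refl)
    fix p assume p: "p \<in> prime_factors m"
    then have "multiplicity p m > 0" using m by (simp add: prime_factors_multiplicity)
    moreover have "multiplicity p m \<le> 1"
      using squarefree_factorial_semiring''[of m] assms m in_prime_factors_imp_prime[OF p] by simp
    ultimately have "multiplicity p m = 1" by linarith
    then show "p ^ multiplicity p m = p" by simp
  qed
  finally show ?thesis unfolding eq .
qed

text \<open>
  Each \<open>n \<le> z\<close> is a square times a squarefree number, and the squarefree number splits into a part
  coprime to \<open>k\<close> and a part dividing \<open>k\<close>.  So the harmonic sum is dominated by the product of the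
  three reciprocal sums over these factors, and the reciprocals of the squares sum to at most \<open>2\<close>.
\<close>
lemma harm_le_sieve_sum:
  fixes k z :: nat
  assumes k: "k > 0"
  shows "harm z \<le> (\<Sum>A\<in>sieve_family k z. 1 / real (\<Prod>A)) * divisor_recip_sum k * 2"
proof -
  define Q where "Q n = {p. prime p \<and> p dvd squarefree_part n}" for n :: nat
  define A where "A n = {p \<in> Q n. \<not> p dvd k}" for n
  define B where "B n = {p \<in> Q n. p dvd k}" for n
  define g where "g n = (A n, \<Prod>(B n), square_part n)" for n
  define F where "F = (\<lambda>(A, a, s). 1 / real (\<Prod>A) * (1 / real a * (1 / (real s)\<^sup>2)))"
  define T where "T = sieve_family k z \<times> {d. d dvd k} \<times> {1..z}"
  have finQ: "finite (Q n)" if "n > 0" for n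
    unfolding Q_def by (rule finite_subset[of _ "{..squarefree_part n}"])
      (auto intro!: dvd_imp_le Nat.gr0I)
  have finAB: "finite (A n)" "finite (B n)" if "n > 0" for n
    using finQ[OF that] unfolding A_def B_def by simp_all
  have decomp: "n = \<Prod>(A n) * \<Prod>(B n) * (square_part n)\<^sup>2" if "n > 0" for n
  proof -
    have "squarefree_part n = \<Prod>(Q n)"
      unfolding Q_def by (rule squarefree_eq_prod_primes) simp
    also have "Q n = A n \<union> B n" by (auto simp: A_def B_def)
    also have "\<Prod>(A n \<union> B n) = \<Prod>(A n) * \<Prod>(B n)"
      using finAB[OF that] by (intro prod.union_disjoint) (auto simp: A_def B_def)
    finally show ?thesis using squarefree_decompose[of n] by simp
  qed
  have g_T: "g n \<in> T" if n: "n \<in> {1..z}" for n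
  proof -
    have n0: "n > 0" using n by auto
    have "\<Prod>(A n) dvd n" "square_part n dvd n"
      by (subst (2) decomp[OF n0], simp)+
    then have "\<Prod>(A n) \<le> n" "square_part n \<le> n" using n0 by (auto intro: dvd_imp_le)
    moreover have "1 \<le> square_part n"
      using n0 by (metis One_nat_def Suc_leI neq0_conv square_part_0_iff)
    moreover have "\<Prod>(B n) dvd k"
      using finAB[OF n0] by (subst prod_dvd_iff_primes) (simp_all add: B_def Q_def)
    moreover have "\<forall>p\<in>A n. prime p \<and> \<not> p dvd k" by (simp add: A_def Q_def)
    ultimately show ?thesis
      using n finAB[OF n0] by (simp add: g_def T_def sieve_family_def)
  qed
  have inj: "inj_on g {1..z}"
  proof (rule inj_onI)
    fix m n assume mn: "m \<in> {1..z}" "n \<in> {1..z}" "g m = g n"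
    then have "m > 0" "n > 0" by auto
    from decomp[OF this(1)] decomp[OF this(2)] mn(3) show "m = n"
      by (simp add: g_def)
  qed
  have "harm z = (\<Sum>n=1..z. F (g n))"
    unfolding harm_def
  proof (intro sum.cong refl)
    fix n assume "n \<in> {1..z}"
    then have "n > 0" by auto
    from arg_cong[OF decomp[OF this], of real]
    have "real n = real (\<Prod>(A n)) * real (\<Prod>(B n)) * (real (square_part n))\<^sup>2"
      by (simp only: of_nat_mult of_nat_power)
    then show "inverse (of_nat n) = F (g n)"
      by (simp add: F_def g_def field_simps)
  qed
  also have "\<dots> = (\<Sum>t\<in>g ` {1..z}. F t)" using inj by (simp add: sum.reindex)
  also have "\<dots> \<le> (\<Sum>t\<in>T. F t)"
  proof (rule sum_mono2)
    show "finite T" using k by (simp add: T_def finite_sieve_family)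
    show "g ` {1..z} \<subseteq> T" using g_T by blast
    show "0 \<le> F t" for t by (cases t) (simp add: F_def prod_nonneg)
  qed
  also have "\<dots> = (\<Sum>A\<in>sieve_family k z. 1 / real (\<Prod>A)) * (divisor_recip_sum k * (\<Sum>s=1..z. 1 / (real s)\<^sup>2))"
    unfolding T_def F_def divisor_recip_sum_def
    by (simp only: sum.cartesian_product[symmetric] sum_product) (simp add: sum_distrib_left sum_distrib_right)
  also have "\<dots> \<le> (\<Sum>A\<in>sieve_family k z. 1 / real (\<Prod>A)) * (divisor_recip_sum k * 2)"
    using sum_inverse_squares_le[of z]
    by (intro mult_left_mono) (auto simp: divisor_recip_sum_def intro!: sum_nonneg prod_nonneg)
  finally show ?thesis by (simp add: mult.assoc)
qed

section \<open>Primes in the progression k n + 1\<close>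

text \<open>
  As \<open>k\<close> is invertible modulo \<open>d\<close>, the solutions form a single residue class modulo \<open>d\<close>.
\<close>
lemma card_dvd_progression:
  fixes d k N :: nat
  assumes d: "d > 0" and cop: "coprime d k"
  shows "\<bar>real (card {n \<in> {1..N}. d dvd k * n + 1}) - real N / real d\<bar> \<le> 1"
proof -
  obtain x where x: "[k * x + 1 = 0] (mod d)"
  proof -
    obtain y where "[int k * y = - 1] (mod int d)"
    proof -
      have "coprime (int k) (int d)" using cop by (simp add: coprime_commute)
      then obtain x where "[int k * x = 1] (mod int d)" using cong_solve_coprime_int by blast
      then have "[int k * (- x) = - 1] (mod int d)" by (metis cong_minus_minus_iff mult_minus_right)
      then show thesis by (rule that)
    qed
    then have "[int k * (y mod int d) + 1 = 0] (mod int d)"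
      by (metis (no_types, lifting) cong_add_rcancel Cong.cong_def mod_mult_right_eq add.left_inverse)
    moreover have "y mod int d = int (nat (y mod int d))" using d by simp
    ultimately have "[int (k * nat (y mod int d) + 1) = int 0] (mod int d)" by (simp add: algebra_simps)
    then show ?thesis using that cong_int_iff by blast
  qed
  \<comment> \<open>The least positive member of the residue class.\<close>
  define r where "r = (if x mod d = 0 then d else x mod d)"
  have r: "1 \<le> r" "r \<le> d" using d by (auto simp: r_def intro: less_imp_le)
  have rx: "[r = x] (mod d)" unfolding r_def Cong.cong_def by simp
  have iff: "d dvd k * n + 1 \<longleftrightarrow> [n = r] (mod d)" for n
  proof -
    have "d dvd k * n + 1 \<longleftrightarrow> [k * n + 1 = k * x + 1] (mod d)"
      using x by (metis cong_0_iff cong_sym cong_trans)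
    also have "\<dots> \<longleftrightarrow> [k * n = k * x] (mod d)" by (rule cong_add_rcancel_nat)
    also have "\<dots> \<longleftrightarrow> [n = x] (mod d)" using cop by (intro cong_mult_lcancel_nat) (simp add: coprime_commute)
    finally show ?thesis using rx cong_sym cong_trans by blast
  qed
  define c where "c = (N + d - r) div d"
  have "{n \<in> {1..N}. d dvd k * n + 1} = (\<lambda>j. r + d * j) ` {..<c}"
  proof (intro equalityI subsetI)
    fix n assume "n \<in> {n \<in> {1..N}. d dvd k * n + 1}"
    then have n: "1 \<le> n" "n \<le> N" "[n = r] (mod d)" using iff by auto
    have "r \<le> n"
    proof (rule ccontr)
      assume "\<not> r \<le> n"
      then have "n < d" "n < r" using r by auto
      then have "n mod d = n" "r mod d = (if r = d then 0 else r)" using r by auto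
      then show False using n \<open>n < r\<close> unfolding Cong.cong_def by (simp split: if_splits)
    qed
    then have "d dvd n - r" using n(3) by (simp add: cong_altdef_nat)
    then obtain j where "n - r = d * j" by blast
    then have j: "n = r + d * j" using \<open>r \<le> n\<close> by simp
    then have "Suc j * d \<le> N + d - r" using n r by (simp add: algebra_simps)
    then have "Suc j \<le> c" unfolding c_def using d by (simp only: less_eq_div_iff_mult_less_eq)
    then show "n \<in> (\<lambda>j. r + d * j) ` {..<c}" using j by auto
  next
    fix n assume "n \<in> (\<lambda>j. r + d * j) ` {..<c}"
    then obtain j where "n = r + d * j" "j < c" by blast
    then have j: "n = r + d * j" "Suc j \<le> c" by auto
    then have "Suc j * d \<le> N + d - r" unfolding c_def using d by (simp only: less_eq_div_iff_mult_less_eq)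
    then have "n \<le> N" using r j by (simp add: algebra_simps)
    moreover have "[n = r] (mod d)" unfolding j Cong.cong_def by simp
    ultimately show "n \<in> {n \<in> {1..N}. d dvd k * n + 1}" using r j iff by auto
  qed
  then have "card {n \<in> {1..N}. d dvd k * n + 1} = c"
    using d by (simp add: card_image inj_on_def)
  moreover have "real c * d \<le> N + d" "real N \<le> real c * d + d"
  proof -
    have "c * d \<le> N + d - r" "N + d - r < c * d + d"
      using div_mult_mod_eq[of "N + d - r" d] mod_less_divisor[OF d, of "N + d - r"]
      unfolding c_def by linarith+
    then have "c * d \<le> N + d" "N \<le> c * d + d" using r by linarith+
    then show "real c * d \<le> N + d" "real N \<le> real c * d + d"
      by (metis of_nat_add of_nat_le_iff of_nat_mult)+
  qed
  ultimately show ?thesis using d by (simp add: abs_le_iff field_simps)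
qed

text \<open>
  A prime \<open>k * n + 1\<close> is divisible by no prime up to \<open>z\<close> unless \<open>k * n + 1 \<le> z\<close>, which happens for
  at most \<open>z\<close> values of \<open>n\<close>; the others survive the sieve.  The term \<open>z ^ 4\<close> is the sieve error.
\<close>
lemma card_prime_progression_le:
  fixes k z N :: nat
  assumes k: "k > 0" and z: "z > 0"
  shows "real (card {n \<in> {1..N}. prime (k * n + 1)})
           \<le> 2 * real N * divisor_recip_sum k / ln (real z + 1) + real (z ^ 4 + z)"
proof -
  define D where "D = sieve_family k z"
  define S where "S = {n \<in> {1..N}. \<forall>p\<in>\<Union>D. n \<notin> {n. p dvd k * n + 1}}"
  define G where "G = (\<Sum>A\<in>D. 1 / real (\<Prod>A))"
  have D: "finite A" "\<And>p. p \<in> A \<Longrightarrow> prime p" "\<And>p. p \<in> A \<Longrightarrow> \<not> p dvd k" "\<Prod>A \<le> z"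
    if "A \<in> D" for A using that by (auto simp: D_def sieve_family_def)
  have "real (card S) \<le> real N / (\<Sum>A\<in>D. 1 / prod real A) + (\<Sum>A\<in>D. prod real A)\<^sup>2"
    unfolding S_def
  proof (rule selberg_sieve)
    show "finite D" by (simp add: D_def finite_sieve_family)
    show "{} \<in> D" using z by (simp add: D_def sieve_family_def)
    show "B \<in> D" if "A \<in> D" "B \<subseteq> A" for A B
      using that unfolding D_def by (rule sieve_family_subset)
    show "real p \<ge> 1" if "A \<in> D" "p \<in> A" for A p
      using D(2)[OF that] prime_ge_1_nat[of p] by simp
    fix A B assume AB: "A \<in> D" "B \<in> D"
    have fin: "finite (A \<union> B)" and prime: "\<And>p. p \<in> A \<union> B \<Longrightarrow> prime p" using D AB by auto
    have "{n \<in> {1..N}. \<forall>p\<in>A \<union> B. n \<in> {n. p dvd k * n + 1}} = {n \<in> {1..N}. \<Prod>(A \<union> B) dvd k * n + 1}"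
      using prod_dvd_iff_primes[OF fin prime] by auto
    moreover have "\<Prod>(A \<union> B) > 0" using prime by (auto intro!: prod_pos dest: prime_gt_0_nat)
    moreover have "coprime (\<Prod>(A \<union> B)) k"
      using D(3) AB prime by (intro prod_coprime_left prime_imp_coprime) auto
    ultimately show "\<bar>real (card {n \<in> {1..N}. \<forall>p\<in>A \<union> B. n \<in> {n. p dvd k * n + 1}}) - real N / prod real (A \<union> B)\<bar> \<le> 1"
      using card_dvd_progression[of "\<Prod>(A \<union> B)" k N] by (simp add: of_nat_prod)
  qed (use D in auto)
  then have "real (card S) \<le> real N / G + (real (\<Sum>A\<in>D. \<Prod>A))\<^sup>2"
    by (simp add: G_def of_nat_prod)
  moreover have "(real (\<Sum>A\<in>D. \<Prod>A))\<^sup>2 \<le> real (z ^ 4)"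
  proof -
    have "(\<Sum>A\<in>D. \<Prod>A)\<^sup>2 \<le> (z\<^sup>2)\<^sup>2"
      unfolding D_def by (intro power_mono sum_prod_sieve_family_le) simp
    then show ?thesis by (simp del: of_nat_sum flip: of_nat_power power_mult)
  qed
  moreover have "real N / G \<le> 2 * real N * divisor_recip_sum k / ln (real z + 1)"
  proof -
    have pos: "0 < ln (real z + 1)" using z by simp
    also have le: "ln (real z + 1) \<le> G * divisor_recip_sum k * 2"
      using ln_le_harm[of z] harm_le_sieve_sum[OF k, of z] unfolding G_def D_def by simp
    finally have "G * divisor_recip_sum k > 0" by simp
    moreover have "divisor_recip_sum k \<ge> 0" by (auto simp: divisor_recip_sum_def intro!: sum_nonneg)
    ultimately have "G > 0" by (simp add: zero_less_mult_iff)
    have "real N * ln (real z + 1) \<le> real N * (G * divisor_recip_sum k * 2)"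
      using le by (intro mult_left_mono) auto
    then show ?thesis using pos \<open>G > 0\<close> by (simp add: field_simps)
  qed
  moreover have "real (card {n \<in> {1..N}. prime (k * n + 1)}) \<le> real (card S) + real z"
  proof -
    have "{n \<in> {1..N}. prime (k * n + 1)} \<subseteq> S \<union> {1..z}"
    proof
      fix n assume n: "n \<in> {n \<in> {1..N}. prime (k * n + 1)}"
      show "n \<in> S \<union> {1..z}"
      proof (cases "n \<le> z")
        case False
        have "\<not> p dvd k * n + 1" if "A \<in> D" "p \<in> A" for A p
        proof
          assume "p dvd k * n + 1"
          then have "p = k * n + 1" using n D(2)[OF that] by (auto dest: primes_dvd_imp_eq)
          moreover have "{p} \<in> D" using that sieve_family_subset[of A k z "{p}"] by (auto simp: D_def)
          then have "p \<le> z" using D(4) by fastforce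
          moreover have "1 * n \<le> k * n" using k by (intro mult_right_mono) auto
          ultimately show False using False by simp
        qed
        then show ?thesis using n by (auto simp: S_def)
      qed (use n in auto)
    qed
    then have "card {n \<in> {1..N}. prime (k * n + 1)} \<le> card (S \<union> {1..z})"
      by (intro card_mono) (auto simp: S_def)
    also have "\<dots> \<le> card S + card {1..z}" by (rule card_Un_le)
    finally show ?thesis by simp
  qed
  ultimately show ?thesis by simp
qed

text \<open>
  After exchanging the summations, a divisor \<open>d\<close> contributes \<open>1 / d\<close> for each of its at most
  \<open>K / d\<close> multiples up to \<open>K\<close>.
\<close>
lemma sum_divisor_recip_sum_le: "(\<Sum>k=1..K. divisor_recip_sum k) \<le> 2 * real K"
proof -
  have "(\<Sum>k=1..K. divisor_recip_sum k) = (\<Sum>k=1..K. \<Sum>d | d \<in> {1..K} \<and> d dvd k. 1 / real d)"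
    unfolding divisor_recip_sum_def
    by (intro sum.cong refl) (auto dest: dvd_imp_le intro!: Nat.gr0I)
  also have "\<dots> = (\<Sum>d=1..K. \<Sum>k | k \<in> {1..K} \<and> d dvd k. 1 / real d)"
    by (intro sum.swap_restrict) auto
  also have "\<dots> \<le> (\<Sum>d=1..K. real K * (1 / (real d)\<^sup>2))"
  proof (intro sum_mono)
    fix d assume d: "d \<in> {1..K}"
    have "{k \<in> {1..K}. d dvd k} \<subseteq> (\<lambda>j. d * j) ` {1..K div d}"
    proof
      fix k assume "k \<in> {k \<in> {1..K}. d dvd k}"
      then obtain j where "k = d * j" "1 \<le> d * j" "d * j \<le> K" by auto
      then show "k \<in> (\<lambda>j. d * j) ` {1..K div d}"
        using d by (auto simp: less_eq_div_iff_mult_less_eq mult.commute intro!: imageI Nat.gr0I)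
    qed
    then have "card {k \<in> {1..K}. d dvd k} \<le> card ((\<lambda>j. d * j) ` {1..K div d})"
      by (intro card_mono) auto
    also have "\<dots> \<le> card {1..K div d}" by (intro card_image_le) auto
    finally have "real (card {k \<in> {1..K}. d dvd k}) \<le> real (K div d)" by simp
    also have "\<dots> \<le> real K / real d" by (rule of_nat_div_le_of_nat)
    finally have "real (card {k \<in> {1..K}. d dvd k}) * (1 / real d) \<le> real K / real d * (1 / real d)"
      by (intro mult_right_mono) auto
    then show "(\<Sum>k | k \<in> {1..K} \<and> d dvd k. 1 / real d) \<le> real K * (1 / (real d)\<^sup>2)"
      by (simp add: power2_eq_square)
  qed
  also have "\<dots> \<le> real K * 2"
    unfolding sum_distrib_left[symmetric] by (intro mult_left_mono sum_inverse_squares_le) auto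
  finally show ?thesis by simp
qed

lemma card_small_multiplier_le:
  fixes K N z :: nat
  assumes z: "z > 0"
  shows "real (card {n \<in> {1..N}. \<exists>k\<in>{1..K}. prime (k * n + 1)})
           \<le> 4 * real N * real K / ln (real z + 1) + real K * real (z ^ 4 + z)"
proof -
  have "{n \<in> {1..N}. \<exists>k\<in>{1..K}. prime (k * n + 1)} = (\<Union>k\<in>{1..K}. {n \<in> {1..N}. prime (k * n + 1)})"
    by auto
  then have "card {n \<in> {1..N}. \<exists>k\<in>{1..K}. prime (k * n + 1)} \<le> (\<Sum>k=1..K. card {n \<in> {1..N}. prime (k * n + 1)})"
    using card_UN_le[of "{1..K}" "\<lambda>k. {n \<in> {1..N}. prime (k * n + 1)}"] by simp
  then have "real (card {n \<in> {1..N}. \<exists>k\<in>{1..K}. prime (k * n + 1)})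
      \<le> (\<Sum>k=1..K. real (card {n \<in> {1..N}. prime (k * n + 1)}))"
    by (simp flip: of_nat_sum)
  also have "\<dots> \<le> (\<Sum>k=1..K. 2 * real N / ln (real z + 1) * divisor_recip_sum k + real (z ^ 4 + z))"
    using card_prime_progression_le[OF _ z] by (intro sum_mono) (auto simp: mult_ac)
  also have "\<dots> = 2 * real N / ln (real z + 1) * (\<Sum>k=1..K. divisor_recip_sum k) + real K * real (z ^ 4 + z)"
    by (simp only: sum.distrib sum_distrib_left[symmetric]) simp
  also have "\<dots> \<le> 2 * real N / ln (real z + 1) * (2 * real K) + real K * real (z ^ 4 + z)"
    by (intro add_right_mono mult_left_mono sum_divisor_recip_sum_le) auto
  finally show ?thesis by simp
qed

section \<open>Small values of kappa\<close>

lemma kappa_pos_prime: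
  assumes n: "n \<ge> 2"
  shows "kappa n > 0" "prime (kappa n * n + 1)"
proof -
  obtain p where p: "prime p" "[p = 1] (mod n)" using exists_prime_cong_1[OF n] by blast
  then have "n dvd p - 1" using prime_ge_1_nat[of p] by (simp add: cong_altdef_nat)
  then obtain k where k: "p - 1 = n * k" by blast
  then have "p = k * n + 1" "k > 0" using prime_gt_1_nat[OF p(1)] by (auto simp: mult.commute intro!: Nat.gr0I)
  then have "k > 0 \<and> prime (k * n + 1)" using p by simp
  from LeastI[of "\<lambda>k. k > 0 \<and> prime (k * n + 1)", OF this]
  show "kappa n > 0" "prime (kappa n * n + 1)" unfolding kappa_def by auto
qed

text \<open>
  The function \<open>t / ln t\<close> increases only for \<open>t \<ge> exp 1\<close>; hence the boundedly many
  \<open>n \<le> exp (exp 1)\<close> are split off (at most \<open>M\<close> of them), and for the other \<open>n \<le> X\<close> the bound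
  \<open>ln n / ln (ln n)\<close> is at most \<open>ln X / ln (ln X)\<close>.
\<close>
theorem lemma9p2p5:
  shows "(\<lambda>X::real. real (card {n::nat. 3 \<le> n \<and> real n \<le> X \<and>
            \<not> real (kappa n) > ln (real n) / ln (ln (real n))}))
         \<in> O[at_top](\<lambda>X. X / ln (ln X))"
proof -
  define Bad where "Bad X = {n::nat. 3 \<le> n \<and> real n \<le> X \<and> \<not> real (kappa n) > ln (real n) / ln (ln (real n))}" for X :: real
  define M where "M = nat \<lceil>exp (exp 1 :: real)\<rceil>"
  \<comment> \<open>The sieve bound at level \<open>z = X powr (1/8)\<close>, where \<open>ln z = ln X / 8\<close> turns \<open>4 / ln z\<close> into
    \<open>32 / ln X\<close> and \<open>z ^ 4 + z\<close> is at most \<open>2 * X powr (1/2)\<close>.\<close>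
  define U where "U X = (ln X / ln (ln X)) * (32 * X / ln X + 2 * X powr (1/2))" for X :: real
  have bound: "real (card (Bad X)) \<le> real M + U X" if X: "X \<ge> exp (exp 1)" for X :: real
  proof -
    define N where "N = nat \<lfloor>X\<rfloor>"
    define K where "K = nat \<lfloor>ln X / ln (ln X)\<rfloor>"
    define z where "z = nat \<lfloor>X powr (1/8)\<rfloor>"
    have lnX: "ln X \<ge> exp 1" using X by (metis exp_gt_zero ln_exp ln_mono order_less_le_trans)
    have llX: "ln (ln X) \<ge> 1" using lnX by (metis exp_gt_zero ln_exp ln_mono order_less_le_trans)
    have "(1::real) < exp 1" by simp
    then have lnX1: "ln X > 1" using lnX by linarith
    have "(1::real) < exp (exp 1)" by simp
    then have X1: "X > 1" using X by linarith
    have K: "real K \<le> ln X / ln (ln X)" using lnX1 llX by (simp add: K_def)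
    have N: "real N \<le> X" using X1 by (simp add: N_def)
    have z8: "real z \<le> X powr (1/8)" by (simp add: z_def)
    have "X powr (1/8) \<ge> 1" using X1 by (intro ge_one_powr_ge_zero) auto
    then have z: "z > 0" by (simp add: z_def)
    have "Bad X \<subseteq> {1..M} \<union> {n \<in> {1..N}. \<exists>k\<in>{1..K}. prime (k * n + 1)}"
    proof
      fix n assume "n \<in> Bad X"
      then have n: "3 \<le> n" "real n \<le> X" "real (kappa n) \<le> ln (real n) / ln (ln (real n))"
        by (auto simp: Bad_def)
      show "n \<in> {1..M} \<union> {n \<in> {1..N}. \<exists>k\<in>{1..K}. prime (k * n + 1)}"
      proof (cases "real n \<le> exp (exp 1)")
        case True
        then have "n \<le> M" unfolding M_def by linarith
        then show ?thesis using n by auto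
      next
        case False
        then have lnn: "ln (real n) \<ge> exp 1" by (metis exp_gt_zero less_imp_le ln_exp ln_mono not_le order_less_trans)
        moreover have "ln (real n) \<le> ln X" using n by (intro ln_mono) auto
        ultimately have "ln (ln X) / ln X \<le> ln (ln (real n)) / ln (real n)"
          by (rule ln_x_over_x_mono)
        moreover have "ln (ln X) / ln X > 0" using lnX1 llX by simp
        ultimately have "inverse (ln (ln (real n)) / ln (real n)) \<le> inverse (ln (ln X) / ln X)"
          by (rule le_imp_inverse_le)
        then have "ln (real n) / ln (ln (real n)) \<le> ln X / ln (ln X)" by simp
        then have "real (kappa n) \<le> ln X / ln (ln X)" using n by simp
        then have "kappa n \<le> K" unfolding K_def by linarith
        moreover have "n \<le> N" using n unfolding N_def by linarith
        ultimately show ?thesis using n kappa_pos_prime[of n] by (auto intro!: bexI[of _ "kappa n"])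
      qed
    qed
    then have "card (Bad X) \<le> card ({1..M} \<union> {n \<in> {1..N}. \<exists>k\<in>{1..K}. prime (k * n + 1)})"
      by (intro card_mono) auto
    also have "\<dots> \<le> M + card {n \<in> {1..N}. \<exists>k\<in>{1..K}. prime (k * n + 1)}"
      by (rule order_trans[OF card_Un_le]) simp
    finally have "real (card (Bad X)) \<le> real M + real (card {n \<in> {1..N}. \<exists>k\<in>{1..K}. prime (k * n + 1)})"
      by linarith
    also have "real (card {n \<in> {1..N}. \<exists>k\<in>{1..K}. prime (k * n + 1)})
        \<le> real K * (4 * real N / ln (real z + 1) + real (z ^ 4 + z))"
      using card_small_multiplier_le[OF z, of N K] by (simp add: algebra_simps)
    also have "\<dots> \<le> ln X / ln (ln X) * (32 * X / ln X + 2 * X powr (1/2))"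
    proof (intro mult_mono add_mono K)
      have "X powr (1/8) \<le> real z + 1" unfolding z_def by linarith
      then have "ln (X powr (1/8)) \<le> ln (real z + 1)" using X1 by (intro ln_mono) auto
      then have "ln X / 8 \<le> ln (real z + 1)" using X1 by (simp add: ln_powr)
      then have "4 * real N / ln (real z + 1) \<le> 4 * X / (ln X / 8)"
        using N lnX1 X1 by (intro frac_le) auto
      then show "4 * real N / ln (real z + 1) \<le> 32 * X / ln X" by simp
      have "z ^ 1 \<le> z ^ 4" using z by (intro power_increasing) auto
      then have "real (z ^ 4 + z) \<le> 2 * real z ^ 4" by (simp flip: of_nat_power)
      also have "real z ^ 4 \<le> (X powr (1/8)) ^ 4" using z8 by (intro power_mono) auto
      also have "(X powr (1/8)) ^ 4 = X powr (1/2)" using X1 by (simp add: powr_powr flip: powr_numeral)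
      finally show "real (z ^ 4 + z) \<le> 2 * X powr (1/2)" by simp
    qed (use lnX1 llX z in auto)
    finally show ?thesis by (simp add: U_def)
  qed
  have "(\<lambda>X. real (card (Bad X))) \<in> O[at_top](\<lambda>X. real M + U X)"
  proof (rule bigoI[where c = 1])
    show "\<forall>\<^sub>F X in at_top. norm (real (card (Bad X))) \<le> 1 * norm (real M + U X)"
      using eventually_ge_at_top[of "exp (exp 1 :: real)"]
      by eventually_elim (use bound in \<open>force intro: order_trans\<close>)
  qed
  also have "(\<lambda>X. real M + U X) \<in> O[at_top](\<lambda>X. X / ln (ln X))"
  proof (rule sum_in_bigo)
    show "(\<lambda>X. real M) \<in> O[at_top](\<lambda>X::real. X / ln (ln X))" by real_asymp
    show "U \<in> O[at_top](\<lambda>X. X / ln (ln X))" unfolding U_def by real_asymp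
  qed
  finally show ?thesis unfolding Bad_def .
qed

end
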